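(* Let $(X,\mu,\ast)$ be a fuzzy metric space and let $A,B,I:X\to X$ be three self-mappings of $X$ such that: (i) the pairs $\{A,I\}$ and $\{B,I\}$ are weakly compatible; (ii) the mappings $A$, $B$ and $I$ satisfy the property (E.A.), i.e. there is a sequence $(x_n)$ in $X$ and a point $u\in X$ such that $\lim_{n\to\infty}Ax_n=\lim_{n\to\infty}Bx_n=\lim_{n\to\infty}Ix_n=u$; (iii) for all $x\neq y$ in $X$ and all $t>0$, $$F\Big(\mu\big(Ax,By,\tfrac t2\big),\ \mu\big(Ix,Iy,\tfrac t2\big),\ \mu\big(Ix,Ax,\tfrac t2\big),\ \mu\big(Iy,By,\tfrac t2\big),\ \mu\big(Ix,By,\tfrac t2\big),\ \mu\big(Iy,Ax,\tfrac t2\big)\Big)\le 1,$$ where $F:[0,1]^6\to\mathbb{R}$ is a continuous function satisfying properties $(F_1)$, $(F_2)$, $(F_3)$ and $(F_4)$; (iv) $I(X)$ is a closed subset of $X$. Then the common fixed point problem of $\{A,B,I\}$ is well-posed.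
   Context: Continuous t-norm: a binary operation $\ast:[0,1]\times[0,1]\to[0,1]$ that is commutative, associative, continuous, satisfies $a\ast 1=a$ for all $a\in[0,1]$, and satisfies $a\ast b\le c\ast d$ whenever $a\le c$, $b\le d$ ($a,b,c,d\in[0,1]$). Fuzzy metric space: a triple $(X,\mu,\ast)$ where $X$ is a set, $\ast$ is a continuous t-norm and $\mu:X^2\times(0,\infty)\to[0,1]$ satisfies, for all $x,y,z\in X$ and $s,t>0$: (i) $\mu(x,y,t)>0$; (ii) $\mu(x,y,t)=1$ if and only if $x=y$; (iii) $\mu(x,y,t)=\mu(y,x,t)$; (iv) $\mu(x,y,s)\ast\mu(y,z,t)\le\mu(x,z,s+t)$; (v) $\mu(x,y,\cdot):(0,\infty)\to(0,1]$ is continuous. Convergence: $x_n\to x$ means $\lim_{n\to\infty}\mu(x_n,x,t)=1$ for every $t>0$. A subset $P\subseteq X$ is closed if whenever a sequence in $P$ converges to $x\in X$, then $x\in P$. Weak compatibility: self-maps $A$ and $B$ of $X$ are weakly compatible if they commute at their coincidence points: $Az=Bz$ implies $ABz=BAz$. Properties of $F$ (a continuous function on $[0,1]^6$): $(F_1)$ $F(u(t),1,1,u(t),u(t),1)>1$ for all $t>0$ with $0\le u(t)<1$; $(F_2)$ $F(u(t),1,u(t),1,1,u(t))>1$ for all $t>0$ with $0\le u(t)<1$; $(F_3)$ $F(u(t),u(t),1,1,u(t),u(t))>1$ for all $t>0$ with $0\le u(t)<1$ (that is, for every real number $u\in[0,1)$ in place of $u(t)$); $(F_4)$ there exists $k\in(0,1)$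 such that, for all functions $u,v,w:(0,\infty)\to[0,1)$, if $F(u(t),v(t),1,w(t),u(t),v(t))\le 1$ for all $t>0$, then $u(t)\ge\frac1k\,w(t)$ for all $t>0$. Well-posedness: for a set $\mathcal{P}$ of self-mappings of $X$, the common fixed point problem of $\mathcal{P}$ is well-posed if (1) $\mathcal{P}$ has a unique common fixed point $x$ in $X$ (that is, $x$ is the unique point of $X$ with $Gx=x$ for all $G\in\mathcal{P}$); and (2) for every sequence $(x_n)$ in $X$ such that $\lim_{n\to\infty}\mu(x_n,Gx_n,t)=1$ for all $G\in\mathcal{P}$ and all $t>0$, one has $\lim_{n\to\infty}\mu(x_n,x,t)=1$ for all $t>0$. *)

theory Defs
  imports "HOL-Analysis.Analysis"
begin

locale continuous_t_norm =
  fixes tn :: "real \<Rightarrow> real \<Rightarrow> real" (infixl \<open>\<ast>\<close> 70)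
  assumes closed: "\<lbrakk>a \<in> {0..1}; b \<in> {0..1}\<rbrakk> \<Longrightarrow> a \<ast> b \<in> {0..1}"
    and commute: "\<lbrakk>a \<in> {0..1}; b \<in> {0..1}\<rbrakk> \<Longrightarrow> a \<ast> b = b \<ast> a"
    and assoc: "\<lbrakk>a \<in> {0..1}; b \<in> {0..1}; c \<in> {0..1}\<rbrakk> \<Longrightarrow> (a \<ast> b) \<ast> c = a \<ast> (b \<ast> c)"
    and continuous: "continuous_on ({0..1} \<times> {0..1}) (\<lambda>(a, b). a \<ast> b)"
    and right_unit: "a \<in> {0..1} \<Longrightarrow> a \<ast> 1 = a"
    and mono: "\<lbrakk>a \<in> {0..1}; b \<in> {0..1}; c \<in> {0..1}; d \<in> {0..1}; a \<le> c; b \<le> d\<rbrakk>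
      \<Longrightarrow> a \<ast> b \<le> c \<ast> d"

text \<open>The space is a carrier set \<open>X\<close>; the values of \<open>\<mu>\<close> outside \<open>X\<close>, or at parameters
  \<open>t \<le> 0\<close>, are unconstrained, as are those of the t-norm outside the unit square.\<close>

locale fuzzy_metric_space = continuous_t_norm tn
  for X :: "'a set" and \<mu> :: "'a \<Rightarrow> 'a \<Rightarrow> real \<Rightarrow> real"
    and tn :: "real \<Rightarrow> real \<Rightarrow> real" (infixl \<open>\<ast>\<close> 70) +
  assumes mu_range: "\<lbrakk>x \<in> X; y \<in> X; t > 0\<rbrakk> \<Longrightarrow> \<mu> x y t \<in> {0..1}"
    and mu_pos: "\<lbrakk>x \<in> X; y \<in> X; t > 0\<rbrakk> \<Longrightarrow> \<mu> x y t > 0"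
    and mu_eq_1_iff: "\<lbrakk>x \<in> X; y \<in> X; t > 0\<rbrakk> \<Longrightarrow> \<mu> x y t = 1 \<longleftrightarrow> x = y"
    and mu_sym: "\<lbrakk>x \<in> X; y \<in> X; t > 0\<rbrakk> \<Longrightarrow> \<mu> x y t = \<mu> y x t"
    and mu_triangle: "\<lbrakk>x \<in> X; y \<in> X; z \<in> X; s > 0; t > 0\<rbrakk>
      \<Longrightarrow> \<mu> x y s \<ast> \<mu> y z t \<le> \<mu> x z (s + t)"
    and mu_continuous: "\<lbrakk>x \<in> X; y \<in> X\<rbrakk> \<Longrightarrow> continuous_on {0<..} (\<mu> x y)"

definition fuzzy_converges :: "('a \<Rightarrow> 'a \<Rightarrow> real \<Rightarrow> real) \<Rightarrow> (nat \<Rightarrow> 'a) \<Rightarrow> 'a \<Rightarrow> bool" where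
  "fuzzy_converges \<mu> xs x \<longleftrightarrow> (\<forall>t>0. (\<lambda>n. \<mu> (xs n) x t) \<longlonglongrightarrow> 1)"

definition fuzzy_closed :: "'a set \<Rightarrow> ('a \<Rightarrow> 'a \<Rightarrow> real \<Rightarrow> real) \<Rightarrow> 'a set \<Rightarrow> bool" where
  "fuzzy_closed X \<mu> P \<longleftrightarrow> P \<subseteq> X \<and>
     (\<forall>xs x. (\<forall>n. xs n \<in> P) \<longrightarrow> x \<in> X \<longrightarrow> fuzzy_converges \<mu> xs x \<longrightarrow> x \<in> P)"

definition weakly_compatible :: "'a set \<Rightarrow> ('a \<Rightarrow> 'a) \<Rightarrow> ('a \<Rightarrow> 'a) \<Rightarrow> bool" where
  "weakly_compatible X A B \<longleftrightarrow> (\<forall>z\<in>X. A z = B z \<longrightarrow> A (B z) = B (A z))"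

definition property_EA ::
  "'a set \<Rightarrow> ('a \<Rightarrow> 'a \<Rightarrow> real \<Rightarrow> real) \<Rightarrow> ('a \<Rightarrow> 'a) \<Rightarrow> ('a \<Rightarrow> 'a) \<Rightarrow> ('a \<Rightarrow> 'a) \<Rightarrow> bool" where
  "property_EA X \<mu> A B I \<longleftrightarrow>
     (\<exists>xs u. (\<forall>n. xs n \<in> X) \<and> u \<in> X \<and>
        fuzzy_converges \<mu> (\<lambda>n. A (xs n)) u \<and>
        fuzzy_converges \<mu> (\<lambda>n. B (xs n)) u \<and>
        fuzzy_converges \<mu> (\<lambda>n. I (xs n)) u)"

type_synonym real6 = "real \<times> real \<times> real \<times> real \<times> real \<times> real"

definition unit_cube6 :: "real6 set" where
  "unit_cube6 = {0..1} \<times> {0..1} \<times> {0..1} \<times> {0..1} \<times> {0..1} \<times> {0..1}"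

definition property_F1 :: "(real6 \<Rightarrow> real) \<Rightarrow> bool" where
  "property_F1 F \<longleftrightarrow> (\<forall>u. 0 \<le> u \<and> u < 1 \<longrightarrow> F (u, 1, 1, u, u, 1) > 1)"

definition property_F2 :: "(real6 \<Rightarrow> real) \<Rightarrow> bool" where
  "property_F2 F \<longleftrightarrow> (\<forall>u. 0 \<le> u \<and> u < 1 \<longrightarrow> F (u, 1, u, 1, 1, u) > 1)"

definition property_F3 :: "(real6 \<Rightarrow> real) \<Rightarrow> bool" where
  "property_F3 F \<longleftrightarrow> (\<forall>u. 0 \<le> u \<and> u < 1 \<longrightarrow> F (u, u, 1, 1, u, u) > 1)"

definition property_F4 :: "(real6 \<Rightarrow> real) \<Rightarrow> bool" where
  "property_F4 F \<longleftrightarrow>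
     (\<exists>k. 0 < k \<and> k < 1 \<and>
        (\<forall>u v w :: real \<Rightarrow> real.
           (\<forall>t>0. u t \<in> {0..<1} \<and> v t \<in> {0..<1} \<and> w t \<in> {0..<1}) \<longrightarrow>
           (\<forall>t>0. F (u t, v t, 1, w t, u t, v t) \<le> 1) \<longrightarrow>
           (\<forall>t>0. u t \<ge> 1 / k * w t)))"

definition common_fixed_point :: "'a set \<Rightarrow> ('a \<Rightarrow> 'a) set \<Rightarrow> 'a \<Rightarrow> bool" where
  "common_fixed_point X \<P> x \<longleftrightarrow> x \<in> X \<and> (\<forall>G\<in>\<P>. G x = x)"

definition well_posed :: "'a set \<Rightarrow> ('a \<Rightarrow> 'a \<Rightarrow> real \<Rightarrow> real) \<Rightarrow> ('a \<Rightarrow> 'a) set \<Rightarrow> bool" where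
  "well_posed X \<mu> \<P> \<longleftrightarrow>
     (\<exists>x. common_fixed_point X \<P> x \<and>
        (\<forall>y. common_fixed_point X \<P> y \<longrightarrow> y = x) \<and>
        (\<forall>xs. (\<forall>n. xs n \<in> X) \<longrightarrow>
           (\<forall>G\<in>\<P>. \<forall>t>0. (\<lambda>n. \<mu> (xs n) (G (xs n)) t) \<longlonglongrightarrow> 1) \<longrightarrow>
           fuzzy_converges \<mu> xs x))"

end

theory Submission
  imports Defs
begin

text \<open>
  The fixed point is the limit \<open>u\<close> supplied by property (E.A.). As \<open>I ` X\<close> is closed, \<open>u = I z\<close> for some \<open>z\<close>.
  Applying the implicit inequality to the pairs \<open>(z, x\<^sub>n)\<close> and \<open>(x\<^sub>n, z)\<close> and letting \<open>n\<close> tend to infinity turns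
  the six arguments of \<open>F\<close> into the patterns excluded by (F2) and (F1) unless \<open>A z = u\<close> and
  \<open>B z = u\<close>. The limit is legitimate because \<open>\<mu>\<close> is continuous in its points
  (\<open>mu_tendsto_right\<close>). Weak compatibility moves the coincidence from \<open>z\<close> to \<open>u = I z\<close>, and
  the pair \<open>(z, u)\<close> then produces the pattern of (F3), so that \<open>u\<close> is fixed. (F3) similarly
  yields uniqueness.

  The second half of well-posedness rests on the fact that the bound in (F4) is too strong to
  be met. Let \<open>p\<close> be the fixed point, and let \<open>x\<^sub>n\<close> be asymptotically fixed by all three maps.
  If \<open>x\<^sub>n\<close>, \<open>B x\<^sub>n\<close>, \<open>I x\<^sub>n\<close> are different from \<open>p\<close>, then (F3) forces \<open>I x\<^sub>n \<noteq> B x\<^sub>n\<close>, so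
  (F4) applies to \<open>(p, x\<^sub>n)\<close> and gives \<open>\<mu> p (B x\<^sub>n) t \<ge> \<mu> (I x\<^sub>n) (B x\<^sub>n) t / k\<close>; hence
  \<open>\<mu> (I x\<^sub>n) (B x\<^sub>n) t \<le> k < 1\<close>. But \<open>\<mu> (I x\<^sub>n) (B x\<^sub>n) t\<close> tends to \<open>1\<close>. Thus for
  all large \<open>n\<close> the point \<open>p\<close> is literally one of \<open>x\<^sub>n\<close>, \<open>B x\<^sub>n\<close>, \<open>I x\<^sub>n\<close>, each of which is
  asymptotically close to \<open>x\<^sub>n\<close>.
\<close>

section \<open>Continuity of a fuzzy metric in its points\<close>

context continuous_t_norm
begin

lemma tn_tendsto:
  assumes "f \<longlonglongrightarrow> a" "g \<longlonglongrightarrow> b" "a \<in> {0..1}" "b \<in> {0..1}"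
    and "\<And>n. f n \<in> {0..1}" "\<And>n. g n \<in> {0..1}"
  shows "(\<lambda>n. f n \<ast> g n) \<longlonglongrightarrow> a \<ast> b"
proof -
  have "(\<lambda>n. (\<lambda>(a, b). a \<ast> b) (f n, g n)) \<longlonglongrightarrow> (\<lambda>(a, b). a \<ast> b) (a, b)"
    by (rule continuous_on_tendsto_compose[OF continuous])
       (use assms in \<open>auto intro!: tendsto_Pair\<close>)
  then show ?thesis by simp
qed

text \<open>No convergence of \<open>f\<close> is required: \<open>c \<ast> b\<close> is close to \<open>c \<ast> 1 = c\<close> for \<open>b\<close> near \<open>1\<close>
  uniformly in \<open>c\<close>, since the t-norm is uniformly continuous on the compact unit square.\<close>

lemma tn_absorb_tendsto_1:
  assumes f: "\<And>n. f n \<in> {0..1}" and g: "\<And>n. g n \<in> {0..1}" and lim: "g \<longlonglongrightarrow> 1"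
  shows "(\<lambda>n. f n - f n \<ast> g n) \<longlonglongrightarrow> 0"
proof (rule LIMSEQ_I)
  fix r :: real assume "r > 0"
  have "uniformly_continuous_on ({0..1} \<times> {0..1}) (\<lambda>(a, b). a \<ast> b)"
    by (intro compact_uniformly_continuous continuous compact_Times compact_Icc)
  then obtain d where d: "d > 0"
    and close: "\<And>p q. \<lbrakk>p \<in> {0..1} \<times> {0..1}; q \<in> {0..1} \<times> {0..1}; dist q p < d\<rbrakk>
      \<Longrightarrow> dist (case q of (a, b) \<Rightarrow> a \<ast> b) (case p of (a, b) \<Rightarrow> a \<ast> b) < r"
    using \<open>r > 0\<close> unfolding uniformly_continuous_on_def by meson
  from LIMSEQ_D[OF lim d] obtain N where N: "\<And>n. n \<ge> N \<Longrightarrow> norm (g n - 1) < d" by auto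
  have "norm (f n - f n \<ast> g n - 0) < r" if "n \<ge> N" for n
    using close[of "(f n, g n)" "(f n, 1)"] N[OF that] f[of n] g[of n]
    by (auto simp: dist_Pair_Pair dist_real_def right_unit abs_minus_commute)
  then show "\<exists>no. \<forall>n\<ge>no. norm (f n - f n \<ast> g n - 0) < r" by blast
qed

end

context fuzzy_metric_space
begin

lemma mu_le_1: "\<lbrakk>x \<in> X; y \<in> X; t > 0\<rbrakk> \<Longrightarrow> \<mu> x y t \<le> 1"
  using mu_range by force

lemma mu_nonneg: "\<lbrakk>x \<in> X; y \<in> X; t > 0\<rbrakk> \<Longrightarrow> 0 \<le> \<mu> x y t"
  using mu_range by force

lemma mu_self: "\<lbrakk>x \<in> X; t > 0\<rbrakk> \<Longrightarrow> \<mu> x x t = 1"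
  by (simp add: mu_eq_1_iff)

lemma mu_less_1: "\<lbrakk>x \<in> X; y \<in> X; t > 0; x \<noteq> y\<rbrakk> \<Longrightarrow> \<mu> x y t < 1"
  using mu_le_1 mu_eq_1_iff by (metis less_eq_real_def)

lemma mu_tendsto_1_trans:
  assumes X: "\<And>n. xs n \<in> X" "\<And>n. ys n \<in> X" "\<And>n. zs n \<in> X"
    and xy: "\<And>t. t > 0 \<Longrightarrow> (\<lambda>n. \<mu> (xs n) (ys n) t) \<longlonglongrightarrow> 1"
    and yz: "\<And>t. t > 0 \<Longrightarrow> (\<lambda>n. \<mu> (ys n) (zs n) t) \<longlonglongrightarrow> 1"
    and t: "t > 0"
  shows "(\<lambda>n. \<mu> (xs n) (zs n) t) \<longlonglongrightarrow> 1"
proof (rule tendsto_sandwich)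
  have t2: "t / 2 > 0" using t by simp
  have "(\<lambda>n. \<mu> (xs n) (ys n) (t/2) \<ast> \<mu> (ys n) (zs n) (t/2)) \<longlonglongrightarrow> 1 \<ast> 1"
    by (rule tn_tendsto) (use X xy[OF t2] yz[OF t2] t2 mu_range in auto)
  then show "(\<lambda>n. \<mu> (xs n) (ys n) (t/2) \<ast> \<mu> (ys n) (zs n) (t/2)) \<longlonglongrightarrow> 1"
    by (simp add: right_unit)
  show "\<forall>\<^sub>F n in sequentially. \<mu> (xs n) (ys n) (t/2) \<ast> \<mu> (ys n) (zs n) (t/2) \<le> \<mu> (xs n) (zs n) t"
    using mu_triangle[OF X t2 t2] by simp
  show "\<forall>\<^sub>F n in sequentially. \<mu> (xs n) (zs n) t \<le> 1"
    using mu_le_1 X t by simp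
qed simp

text \<open>The triangle inequality traps \<open>\<mu> a (ys n) t\<close> between \<open>\<mu> a y (t - e)\<close> and \<open>\<mu> a y (t + e)\<close>
  up to a vanishing error; continuity in \<open>t\<close> then closes the gap.\<close>

lemma mu_tendsto_right:
  assumes a: "a \<in> X" and ys: "\<And>n. ys n \<in> X" and y: "y \<in> X"
    and lim: "fuzzy_converges \<mu> ys y" and t: "t > 0"
  shows "(\<lambda>n. \<mu> a (ys n) t) \<longlonglongrightarrow> \<mu> a y t"
proof (rule order_tendstoI)
  have "isCont (\<mu> a y) t"
    using mu_continuous[OF a y] t by (simp add: continuous_on_eq_continuous_at)
  then have at_t: "(\<mu> a y \<longlongrightarrow> \<mu> a y t) (at t)" by (simp add: isCont_def)
  have lim1: "(\<lambda>n. \<mu> (ys n) y e) \<longlonglongrightarrow> 1" if "e > 0" for e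
    using lim that by (auto simp: fuzzy_converges_def)
  {
    fix c assume c: "c < \<mu> a y t"
    have "\<forall>\<^sub>F s in at_left t. c < \<mu> a y s"
      by (rule order_tendstoD(1)[OF _ c]) (use at_t in \<open>simp add: filterlim_at_split\<close>)
    moreover have "\<forall>\<^sub>F s in at_left t. 0 < s \<and> s < t"
      using t by (auto simp: eventually_at_left)
    ultimately have "\<forall>\<^sub>F s in at_left t. c < \<mu> a y s \<and> 0 < s \<and> s < t"
      by eventually_elim auto
    then obtain s where s: "c < \<mu> a y s" "0 < s" "s < t"
      using eventually_happens trivial_limit_at_left_real by blast
    have pos: "t - s > 0" using s by simp
    have "(\<lambda>n. \<mu> a y s \<ast> \<mu> (ys n) y (t - s)) \<longlonglongrightarrow> \<mu> a y s \<ast> 1"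
      by (rule tn_tendsto) (use a ys y s lim1[OF pos] mu_range in auto)
    then have "(\<lambda>n. \<mu> a y s \<ast> \<mu> (ys n) y (t - s)) \<longlonglongrightarrow> \<mu> a y s"
      using right_unit mu_range a y s by simp
    from order_tendstoD(1)[OF this s(1)] show "\<forall>\<^sub>F n in sequentially. c < \<mu> a (ys n) t"
    proof eventually_elim
      case (elim n)
      show ?case
        using elim mu_triangle[OF a y ys s(2) pos, of n] mu_sym[OF y ys pos, of n] by simp
    qed
  }
  {
    fix c assume c: "\<mu> a y t < c"
    have "\<forall>\<^sub>F s in at_right t. \<mu> a y s < c"
      by (rule order_tendstoD(2)[OF _ c]) (use at_t in \<open>simp add: filterlim_at_split\<close>)
    moreover have "\<forall>\<^sub>F s in at_right t. t < s"
      by (simp add: eventually_at_filter)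
    ultimately have "\<forall>\<^sub>F s in at_right t. \<mu> a y s < c \<and> t < s"
      by eventually_elim auto
    then obtain s where s: "\<mu> a y s < c" "t < s"
      using eventually_happens trivial_limit_at_right_real by blast
    have pos: "s - t > 0" using s by simp
    have "(\<lambda>n. \<mu> a (ys n) t - \<mu> a (ys n) t \<ast> \<mu> (ys n) y (s - t)) \<longlonglongrightarrow> 0"
      by (rule tn_absorb_tendsto_1) (use a ys y t pos lim1[OF pos] mu_range in auto)
    from order_tendstoD(2)[OF this, of "c - \<mu> a y s"] s
    have "\<forall>\<^sub>F n in sequentially.
        \<mu> a (ys n) t - \<mu> a (ys n) t \<ast> \<mu> (ys n) y (s - t) < c - \<mu> a y s" by simp
    then show "\<forall>\<^sub>F n in sequentially. \<mu> a (ys n) t < c"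
    proof eventually_elim
      case (elim n)
      show ?case using elim mu_triangle[OF a ys y t pos, of n] by simp
    qed
  }
qed

lemma mu_tendsto_left:
  assumes "a \<in> X" "\<And>n. ys n \<in> X" "y \<in> X" "fuzzy_converges \<mu> ys y" "t > 0"
  shows "(\<lambda>n. \<mu> (ys n) a t) \<longlonglongrightarrow> \<mu> y a t"
  using mu_tendsto_right[OF assms] mu_sym assms by simp

lemma mu_tendsto_1_common_limit:
  assumes xs: "\<And>n. xs n \<in> X" and ys: "\<And>n. ys n \<in> X" and u: "u \<in> X"
    and "fuzzy_converges \<mu> xs u" "fuzzy_converges \<mu> ys u" and t: "t > 0"
  shows "(\<lambda>n. \<mu> (xs n) (ys n) t) \<longlonglongrightarrow> 1"
proof (rule mu_tendsto_1_trans[OF xs _ ys, where ys = "\<lambda>_. u"])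
  show "(\<lambda>n. \<mu> u (ys n) s) \<longlonglongrightarrow> 1" if "s > 0" for s
    using mu_tendsto_right[OF u ys u assms(5) that] mu_self[OF u that] by simp
qed (use assms in \<open>auto simp: fuzzy_converges_def\<close>)

text \<open>A sequence whose \<open>A\<close>-images tend to \<open>u \<noteq> A z\<close> can visit \<open>z\<close> only finitely often. This
  makes an inequality that is available only for distinct points usable along the sequence.\<close>

lemma eventually_neq_if_image_converges:
  assumes A: "A \<in> X \<rightarrow> X" and "u \<in> X" "z \<in> X"
    and lim: "fuzzy_converges \<mu> (\<lambda>n. A (xs n)) u" and neq: "A z \<noteq> u"
  shows "\<forall>\<^sub>F n in sequentially. xs n \<noteq> z"
proof -
  have "(\<lambda>n. \<mu> (A (xs n)) u 1) \<longlonglongrightarrow> 1" using lim by (simp add: fuzzy_converges_def)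
  moreover have "\<mu> (A z) u 1 < 1" using assms by (auto intro: mu_less_1)
  ultimately have "\<forall>\<^sub>F n in sequentially. \<mu> (A z) u 1 < \<mu> (A (xs n)) u 1"
    by (rule order_tendstoD(1))
  then show ?thesis by eventually_elim auto
qed

end

section \<open>Triples of maps satisfying an implicit inequality\<close>

lemma tendsto_le_on_unit_cube6:
  fixes F :: "real6 \<Rightarrow> real"
  assumes F: "continuous_on unit_cube6 F"
    and lim: "a \<longlonglongrightarrow> a'" "b \<longlonglongrightarrow> b'" "c \<longlonglongrightarrow> c'" "d \<longlonglongrightarrow> d'" "e \<longlonglongrightarrow> e'" "f \<longlonglongrightarrow> f'"
    and cube: "\<And>n. (a n, b n, c n, d n, e n, f n) \<in> unit_cube6"
      "(a', b', c', d', e', f') \<in> unit_cube6"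
    and le: "\<forall>\<^sub>F n in sequentially. F (a n, b n, c n, d n, e n, f n) \<le> r"
  shows "F (a', b', c', d', e', f') \<le> r"
proof (rule tendsto_upperbound[OF _ le])
  show "(\<lambda>n. F (a n, b n, c n, d n, e n, f n)) \<longlonglongrightarrow> F (a', b', c', d', e', f')"
    by (rule continuous_on_tendsto_compose[OF F]) (use lim cube in \<open>auto intro!: tendsto_Pair\<close>)
qed simp

locale implicit_contraction = fuzzy_metric_space X \<mu> tn
  for X :: "'a set" and \<mu> :: "'a \<Rightarrow> 'a \<Rightarrow> real \<Rightarrow> real"
    and tn :: "real \<Rightarrow> real \<Rightarrow> real" (infixl \<open>\<ast>\<close> 70) +
  fixes A B I :: "'a \<Rightarrow> 'a" and F :: "real6 \<Rightarrow> real"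
  assumes A: "A \<in> X \<rightarrow> X" and B: "B \<in> X \<rightarrow> X" and I: "I \<in> X \<rightarrow> X"
    and contraction: "\<lbrakk>x \<in> X; y \<in> X; x \<noteq> y; t > 0\<rbrakk> \<Longrightarrow>
      F (\<mu> (A x) (B y) t, \<mu> (I x) (I y) t, \<mu> (I x) (A x) t,
         \<mu> (I y) (B y) t, \<mu> (I x) (B y) t, \<mu> (I y) (A x) t) \<le> 1"
begin

lemma maps_in [simp]:
  "x \<in> X \<Longrightarrow> A x \<in> X" "x \<in> X \<Longrightarrow> B x \<in> X" "x \<in> X \<Longrightarrow> I x \<in> X"
  using A B I by auto

text \<open>The inequality for \<open>(z, x\<^sub>n)\<close> tends to \<open>F (m, 1, m, 1, 1, m) \<le> 1\<close>, where \<open>m\<close> is the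
  nearness of \<open>A z\<close> and \<open>u\<close>; (F2) rules out \<open>m < 1\<close>. Any fixed parameter will do, here \<open>1\<close>.\<close>

lemma coincidence_A:
  assumes F: "continuous_on unit_cube6 F" and F2: "property_F2 F"
    and xs: "\<And>n. xs n \<in> X" and u: "u \<in> X" and z: "z \<in> X" and Iz: "I z = u"
    and limA: "fuzzy_converges \<mu> (\<lambda>n. A (xs n)) u"
    and limB: "fuzzy_converges \<mu> (\<lambda>n. B (xs n)) u"
    and limI: "fuzzy_converges \<mu> (\<lambda>n. I (xs n)) u"
  shows "A z = u"
proof (rule ccontr)
  assume neq: "A z \<noteq> u"
  define m where "m = \<mu> (A z) u 1"
  have m: "0 \<le> m" "m < 1"
    using mu_pos[of "A z" u 1] mu_less_1[of "A z" u 1] neq u z by (auto simp: m_def)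
  note in_X = xs u z Iz
  have "F (m, 1, m, 1, 1, m) \<le> 1"
  proof (rule tendsto_le_on_unit_cube6[OF F])
    show "(\<lambda>n. \<mu> (A z) (B (xs n)) 1) \<longlonglongrightarrow> m"
      unfolding m_def by (rule mu_tendsto_right) (use in_X limB in auto)
    show "(\<lambda>n. \<mu> (I z) (I (xs n)) 1) \<longlonglongrightarrow> 1"
      by (rule mu_tendsto_1_common_limit[where u = u])
         (use in_X limI mu_self in \<open>auto simp: fuzzy_converges_def\<close>)
    show "(\<lambda>n. \<mu> (I z) (A z) 1) \<longlonglongrightarrow> m"
      using mu_sym[of u "A z" 1] in_X by (simp add: m_def)
    show "(\<lambda>n. \<mu> (I (xs n)) (B (xs n)) 1) \<longlonglongrightarrow> 1"
      by (rule mu_tendsto_1_common_limit) (use in_X limI limB in auto)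
    show "(\<lambda>n. \<mu> (I z) (B (xs n)) 1) \<longlonglongrightarrow> 1"
      by (rule mu_tendsto_1_common_limit[where u = u])
         (use in_X limB mu_self in \<open>auto simp: fuzzy_converges_def\<close>)
    have "(\<lambda>n. \<mu> (I (xs n)) (A z) 1) \<longlonglongrightarrow> \<mu> u (A z) 1"
      by (rule mu_tendsto_left) (use in_X limI in auto)
    then show "(\<lambda>n. \<mu> (I (xs n)) (A z) 1) \<longlonglongrightarrow> m"
      using mu_sym[of u "A z" 1] in_X by (simp add: m_def)
    show "\<forall>\<^sub>F n in sequentially. F (\<mu> (A z) (B (xs n)) 1, \<mu> (I z) (I (xs n)) 1,
        \<mu> (I z) (A z) 1, \<mu> (I (xs n)) (B (xs n)) 1, \<mu> (I z) (B (xs n)) 1,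
        \<mu> (I (xs n)) (A z) 1) \<le> 1"
      using eventually_neq_if_image_converges[OF A u z limA neq]
      by eventually_elim (use contraction in_X in auto)
  qed (use m in_X in \<open>auto simp: unit_cube6_def mu_nonneg mu_le_1\<close>)
  then show False using F2 m by (force simp: property_F2_def)
qed

text \<open>With the roles exchanged, \<open>(x\<^sub>n, z)\<close> leads to \<open>F (m, 1, 1, m, m, 1) \<le> 1\<close> instead, because
  the inequality is not symmetric in \<open>A\<close> and \<open>B\<close>; this is the pattern of (F1).\<close>

lemma coincidence_B:
  assumes F: "continuous_on unit_cube6 F" and F1: "property_F1 F"
    and xs: "\<And>n. xs n \<in> X" and u: "u \<in> X" and z: "z \<in> X" and Iz: "I z = u"
    and limA: "fuzzy_converges \<mu> (\<lambda>n. A (xs n)) u"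
    and limB: "fuzzy_converges \<mu> (\<lambda>n. B (xs n)) u"
    and limI: "fuzzy_converges \<mu> (\<lambda>n. I (xs n)) u"
  shows "B z = u"
proof (rule ccontr)
  assume neq: "B z \<noteq> u"
  define m where "m = \<mu> u (B z) 1"
  have m: "0 \<le> m" "m < 1"
    using mu_pos[of u "B z" 1] mu_less_1[of u "B z" 1] neq u z by (auto simp: m_def)
  note in_X = xs u z Iz
  have "F (m, 1, 1, m, m, 1) \<le> 1"
  proof (rule tendsto_le_on_unit_cube6[OF F])
    show "(\<lambda>n. \<mu> (A (xs n)) (B z) 1) \<longlonglongrightarrow> m"
      unfolding m_def by (rule mu_tendsto_left) (use in_X limA in auto)
    show "(\<lambda>n. \<mu> (I (xs n)) (I z) 1) \<longlonglongrightarrow> 1"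
      using limI Iz by (simp add: fuzzy_converges_def)
    show "(\<lambda>n. \<mu> (I (xs n)) (A (xs n)) 1) \<longlonglongrightarrow> 1"
      by (rule mu_tendsto_1_common_limit) (use in_X limI limA in auto)
    show "(\<lambda>n. \<mu> (I z) (B z) 1) \<longlonglongrightarrow> m"
      using Iz by (simp add: m_def)
    show "(\<lambda>n. \<mu> (I (xs n)) (B z) 1) \<longlonglongrightarrow> m"
      unfolding m_def by (rule mu_tendsto_left) (use in_X limI in auto)
    show "(\<lambda>n. \<mu> (I z) (A (xs n)) 1) \<longlonglongrightarrow> 1"
      by (rule mu_tendsto_1_common_limit[where u = u])
         (use in_X limA mu_self in \<open>auto simp: fuzzy_converges_def\<close>)
    show "\<forall>\<^sub>F n in sequentially. F (\<mu> (A (xs n)) (B z) 1, \<mu> (I (xs n)) (I z) 1,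
        \<mu> (I (xs n)) (A (xs n)) 1, \<mu> (I z) (B z) 1, \<mu> (I (xs n)) (B z) 1,
        \<mu> (I z) (A (xs n)) 1) \<le> 1"
      using eventually_neq_if_image_converges[OF B u z limB neq]
      by eventually_elim (use contraction in_X in auto)
  qed (use m in_X in \<open>auto simp: unit_cube6_def mu_nonneg mu_le_1\<close>)
  then show False using F1 m by (force simp: property_F1_def)
qed

text \<open>Between a coincidence point of \<open>A\<close> and \<open>I\<close> and one of \<open>B\<close> and \<open>I\<close> the six distances
  collapse to \<open>u, u, 1, 1, u, u\<close>, and (F3) leaves only \<open>u = 1\<close>.\<close>

lemma coincidence_values_eq:
  assumes F3: "property_F3 F" and x: "x \<in> X" and y: "y \<in> X"
    and Ax: "A x = I x" and By: "B y = I y" and neq: "x \<noteq> y"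
  shows "I x = I y"
proof (rule ccontr)
  assume ne: "I x \<noteq> I y"
  define m where "m = \<mu> (I x) (I y) 1"
  have m: "0 \<le> m" "m < 1"
    using mu_pos[of "I x" "I y" 1] mu_less_1[of "I x" "I y" 1] ne x y by (auto simp: m_def)
  have "F (m, m, 1, 1, m, m) \<le> 1"
    using contraction[OF x y neq, of 1] mu_self[of "I x" 1] mu_self[of "I y" 1]
      mu_sym[of "I y" "I x" 1] x y
    by (simp add: Ax By m_def)
  then show False using F3 m by (force simp: property_F3_def)
qed

lemma common_fixed_point_exists:
  assumes wcA: "weakly_compatible X A I" and wcB: "weakly_compatible X B I"
    and EA: "property_EA X \<mu> A B I" and closed: "fuzzy_closed X \<mu> (I ` X)"
    and F: "continuous_on unit_cube6 F"
    and F123: "property_F1 F" "property_F2 F" "property_F3 F"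
  obtains p where "common_fixed_point X {A, B, I} p"
proof -
  obtain xs u where xs: "\<And>n. xs n \<in> X" and u: "u \<in> X"
    and limA: "fuzzy_converges \<mu> (\<lambda>n. A (xs n)) u"
    and limB: "fuzzy_converges \<mu> (\<lambda>n. B (xs n)) u"
    and limI: "fuzzy_converges \<mu> (\<lambda>n. I (xs n)) u"
    using EA unfolding property_EA_def by blast
  have "u \<in> I ` X"
    using closed[unfolded fuzzy_closed_def, THEN conjunct2, rule_format,
        of "\<lambda>n. I (xs n)" u] xs u limI by simp
  then obtain z where z: "z \<in> X" and Iz: "I z = u" by blast
  have Az: "A z = u" by (rule coincidence_A) fact+
  have Bz: "B z = u" by (rule coincidence_B) fact+
  have Au: "A u = I u" and Bu: "B u = I u"
    using wcA wcB z Az Bz Iz unfolding weakly_compatible_def by metis+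
  have "I u = u"
  proof (cases "z = u")
    case True
    then show ?thesis using Iz by simp
  next
    case False
    then show ?thesis using coincidence_values_eq[OF F123(3) z u] Az Bu Iz by simp
  qed
  with Au Bu u that show thesis by (simp add: common_fixed_point_def)
qed

lemma common_fixed_point_unique:
  assumes "property_F3 F" "common_fixed_point X {A, B, I} p" "common_fixed_point X {A, B, I} q"
  shows "q = p"
  using coincidence_values_eq[OF assms(1), of p q] assms(2,3)
  by (auto simp: common_fixed_point_def)

text \<open>The bound of (F4) with its factor \<open>1 / k > 1\<close> keeps \<open>I y\<close> and \<open>B y\<close> apart by a fixed
  amount, independent of \<open>y\<close>, unless the fixed point is one of \<open>y\<close>, \<open>B y\<close>, \<open>I y\<close>. The
  distinctness of \<open>I y\<close> and \<open>B y\<close>, needed to bring (F4) into play, comes from (F3).\<close>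

lemma separation_away_from_fixed_point:
  assumes F3: "property_F3 F" and F4: "property_F4 F"
    and p: "common_fixed_point X {A, B, I} p"
  obtains k where "k < 1"
    "\<And>y. \<lbrakk>y \<in> X; p \<noteq> y; p \<noteq> B y; p \<noteq> I y\<rbrakk> \<Longrightarrow> \<mu> (I y) (B y) 1 \<le> k"
proof -
  have pX: "p \<in> X" and fixed: "A p = p" "B p = p" "I p = p"
    using p by (auto simp: common_fixed_point_def)
  obtain k where k: "0 < k" "k < 1"
    and bound: "\<And>u v w :: real \<Rightarrow> real.
      \<lbrakk>\<forall>t>0. u t \<in> {0..<1} \<and> v t \<in> {0..<1} \<and> w t \<in> {0..<1};
       \<forall>t>0. F (u t, v t, 1, w t, u t, v t) \<le> 1\<rbrakk> \<Longrightarrow> \<forall>t>0. u t \<ge> 1 / k * w t"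
    using F4 unfolding property_F4_def by blast
  show thesis
  proof (rule that[OF k(2)])
    fix y assume y: "y \<in> X" and ne: "p \<noteq> y" "p \<noteq> B y" "p \<noteq> I y"
    have IB: "I y \<noteq> B y"
      using coincidence_values_eq[OF F3 pX y] ne fixed by auto
    have unit: "\<mu> a b t \<in> {0..<1}" if "a \<in> X" "b \<in> X" "a \<noteq> b" "t > 0" for a b t
      using mu_pos[of a b t] mu_less_1[of a b t] that by auto
    have "\<forall>t>0. \<mu> p (B y) t \<ge> 1 / k * \<mu> (I y) (B y) t"
    proof (rule bound)
      show "\<forall>t>0. \<mu> p (B y) t \<in> {0..<1} \<and> \<mu> p (I y) t \<in> {0..<1} \<and> \<mu> (I y) (B y) t \<in> {0..<1}"
        using unit pX y ne IB by simp
      show "\<forall>t>0. F (\<mu> p (B y) t, \<mu> p (I y) t, 1, \<mu> (I y) (B y) t, \<mu> p (B y) t, \<mu> p (I y) t) \<le> 1"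
      proof (intro allI impI)
        fix t :: real assume t: "t > 0"
        show "F (\<mu> p (B y) t, \<mu> p (I y) t, 1, \<mu> (I y) (B y) t, \<mu> p (B y) t, \<mu> p (I y) t) \<le> 1"
          using contraction[OF pX y ne(1) t] mu_self[OF pX t] mu_sym[of "I y" p t] fixed pX y t
          by simp
      qed
    qed
    then have "1 / k * \<mu> (I y) (B y) 1 \<le> \<mu> p (B y) 1" by simp
    also have "\<dots> \<le> 1" using mu_le_1 pX y by simp
    finally show "\<mu> (I y) (B y) 1 \<le> k" using k by (simp add: field_simps)
  qed
qed

text \<open>Since \<open>I x\<^sub>n\<close> and \<open>B x\<^sub>n\<close> both stay close to \<open>x\<^sub>n\<close>, they come closer to each other than the
  separation constant permits, so eventually \<open>p\<close> is one of \<open>x\<^sub>n\<close>, \<open>B x\<^sub>n\<close>, \<open>I x\<^sub>n\<close>, and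
  \<open>\<mu> x\<^sub>n p t\<close> is one of \<open>1\<close>, \<open>\<mu> x\<^sub>n (B x\<^sub>n) t\<close>, \<open>\<mu> x\<^sub>n (I x\<^sub>n) t\<close>.\<close>

lemma asymptotically_fixed_converges:
  assumes F3: "property_F3 F" and F4: "property_F4 F"
    and p: "common_fixed_point X {A, B, I} p" and xs: "\<And>n. xs n \<in> X"
    and limB: "\<And>t. t > 0 \<Longrightarrow> (\<lambda>n. \<mu> (xs n) (B (xs n)) t) \<longlonglongrightarrow> 1"
    and limI: "\<And>t. t > 0 \<Longrightarrow> (\<lambda>n. \<mu> (xs n) (I (xs n)) t) \<longlonglongrightarrow> 1"
  shows "fuzzy_converges \<mu> xs p"
  unfolding fuzzy_converges_def
proof (intro allI impI)
  fix t :: real assume t: "t > 0"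
  have pX: "p \<in> X" using p by (simp add: common_fixed_point_def)
  obtain k where k: "k < 1"
    and sep: "\<And>y. \<lbrakk>y \<in> X; p \<noteq> y; p \<noteq> B y; p \<noteq> I y\<rbrakk> \<Longrightarrow> \<mu> (I y) (B y) 1 \<le> k"
    using separation_away_from_fixed_point[OF F3 F4 p] by blast
  have "(\<lambda>n. \<mu> (I (xs n)) (B (xs n)) 1) \<longlonglongrightarrow> 1"
  proof (rule mu_tendsto_1_trans[where ys = xs])
    show "(\<lambda>n. \<mu> (I (xs n)) (xs n) s) \<longlonglongrightarrow> 1" if "s > 0" for s
      using limI[OF that] mu_sym[OF xs maps_in(3)[OF xs] that] by simp
  qed (use xs limB in auto)
  from order_tendstoD(1)[OF this k]
  have hit: "\<forall>\<^sub>F n in sequentially. p = xs n \<or> p = B (xs n) \<or> p = I (xs n)"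
    by eventually_elim (use sep xs in force)
  show "(\<lambda>n. \<mu> (xs n) p t) \<longlonglongrightarrow> 1"
  proof (rule tendsto_sandwich)
    show "(\<lambda>n. min (\<mu> (xs n) (B (xs n)) t) (\<mu> (xs n) (I (xs n)) t)) \<longlonglongrightarrow> 1"
      using tendsto_min[OF limB[OF t] limI[OF t]] by simp
    show "\<forall>\<^sub>F n in sequentially.
        min (\<mu> (xs n) (B (xs n)) t) (\<mu> (xs n) (I (xs n)) t) \<le> \<mu> (xs n) p t"
      using hit
    proof eventually_elim
      case (elim n)
      then show ?case
        using mu_self[OF pX t] mu_le_1[OF xs[of n] maps_in(2)[OF xs[of n]] t] by auto
    qed
    show "\<forall>\<^sub>F n in sequentially. \<mu> (xs n) p t \<le> 1" using mu_le_1[OF xs pX t] by simp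
  qed simp
qed

end

section \<open>Well-posedness of the common fixed point problem\<close>

theorem theorem5p2:
  fixes X :: "'a set" and \<mu> :: "'a \<Rightarrow> 'a \<Rightarrow> real \<Rightarrow> real" and tn :: "real \<Rightarrow> real \<Rightarrow> real"
    and A B I :: "'a \<Rightarrow> 'a" and F :: "real6 \<Rightarrow> real"
  assumes "fuzzy_metric_space X \<mu> tn"
    and "A \<in> X \<rightarrow> X" and "B \<in> X \<rightarrow> X" and "I \<in> X \<rightarrow> X"
    and "weakly_compatible X A I" and "weakly_compatible X B I"
    and "property_EA X \<mu> A B I"
    and "continuous_on unit_cube6 F"
    and "property_F1 F" and "property_F2 F" and "property_F3 F" and "property_F4 F"
    and "\<And>x y t. \<lbrakk>x \<in> X; y \<in> X; x \<noteq> y; t > 0\<rbrakk> \<Longrightarrow>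
      F (\<mu> (A x) (B y) (t / 2), \<mu> (I x) (I y) (t / 2), \<mu> (I x) (A x) (t / 2),
         \<mu> (I y) (B y) (t / 2), \<mu> (I x) (B y) (t / 2), \<mu> (I y) (A x) (t / 2)) \<le> 1"
    and "fuzzy_closed X \<mu> (I ` X)"
  shows "well_posed X \<mu> {A, B, I}"
proof -
  interpret fuzzy_metric_space X \<mu> tn by fact
  interpret implicit_contraction X \<mu> tn A B I F
  proof unfold_locales
    \<comment> \<open>As \<open>t\<close> is arbitrary, the halved parameter may be replaced by \<open>t\<close> itself.\<close>
    fix x y and t :: real assume "x \<in> X" "y \<in> X" "x \<noteq> y" "t > 0"
    then show "F (\<mu> (A x) (B y) t, \<mu> (I x) (I y) t, \<mu> (I x) (A x) t,
        \<mu> (I y) (B y) t, \<mu> (I x) (B y) t, \<mu> (I y) (A x) t) \<le> 1"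
      using assms(13)[of x y "2 * t"] by simp
  qed (use assms in auto)
  obtain p where p: "common_fixed_point X {A, B, I} p"
    using common_fixed_point_exists assms by blast
  have unique: "q = p" if "common_fixed_point X {A, B, I} q" for q
    using common_fixed_point_unique[OF \<open>property_F3 F\<close> p that] .
  have "fuzzy_converges \<mu> xs p" if xs: "\<And>n. xs n \<in> X"
    and lim: "\<forall>G\<in>{A, B, I}. \<forall>t>0. (\<lambda>n. \<mu> (xs n) (G (xs n)) t) \<longlonglongrightarrow> 1" for xs
    by (rule asymptotically_fixed_converges[OF \<open>property_F3 F\<close> \<open>property_F4 F\<close> p xs])
       (use lim in auto)
  with p unique show ?thesis unfolding well_posed_def by blast
qed

end
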